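(* Let $(T,\mu,\eta)$ be an ordered saturation monad on $\mathsf{C}$ with saturation $(-)^*$, let $S:\mathsf{C}\to\mathsf{C}$ be a functor lifting to $\overline{S}:\mathcal{K}l(T)\to\mathcal{K}l(T)$, and let $(\overline{S},m,e)$ be a monad on $\mathcal{K}l(T)$. Assume $\overline{S}$ is locally monotonic and that for every $\alpha:X\rightsquigarrow\overline{S}X$ in $\mathcal{K}l(T)$, $$m_X\cdot\overline{S}\big[(m_X\cdot\overline{S}\alpha)^*\cdot e_X\big]=(m_X\cdot\overline{S}\alpha)^*.$$ Then the monad $TS$ (described in the context) is an ordered saturation monad.
   Context: Kleisli category $\mathcal{K}l(T)$: morphisms $X\rightsquigarrow Y$ are morphisms $X\to TY$, composition $g\cdot f=\mu_Z\circ Tg\circ f$, identity $1_X=\eta_X$; $f^\sharp=\eta_Y\circ f$. $S$ lifts to $\overline{S}$ if $\overline{S}X=SX$ and $\overline{S}(f^\sharp)=(Sf)^\sharp$. $\overline{S}$ is locally monotonic if $f\le g$ implies $\overline{S}f\le\overline{S}g$. The monad structure on $TS$ is the one obtained by composing the adjunctions $\mathsf{C}\rightleftarrows\mathcal{K}l(T)\rightleftarrows\mathcal{K}l(\overline{S})$: its Kleisli category has $Hom(X,Y)=Hom_{\mathcal{K}l(T)}(X,SY)$, composition $g\bullet f=m_Z\cdot\overline{S}g\cdot f$, identities $e_X$, and for $f:X\to Y$ in $\mathsf{C}$ the induced Kleisli morphism is $e_Y\cdot f^\sharp$; its hom-sets are ordered by the order of $\mathcal{K}l(T)$. Ordered saturation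 monad (for a monad $M$ on $\mathsf{C}$ with Kleisli composition $\cdot$, identities $1$, and $f^\sharp$ the Kleisli morphism induced by $f$ of $\mathsf{C}$): $\mathcal{K}l(M)$ order enriched (hom-sets posets, composition monotone) and for each $\alpha:X\rightsquigarrow X$ there is $\alpha^*$ with (1) $1\le\alpha^*$; (2) $\alpha\le\alpha^*$; (3) $\alpha^*\cdot\alpha^*\le\alpha^*$; (4) $\alpha^*\le\beta$ whenever $1\le\beta$, $\alpha\le\beta$, $\beta\cdot\beta\le\beta$; (5) for $f:X\to Y$ in $\mathsf{C}$ and $\beta:Y\rightsquigarrow Y$, $f^\sharp\cdot\alpha\le\beta\cdot f^\sharp\Rightarrow f^\sharp\cdot\alpha^*\le\beta^*\cdot f^\sharp$, and likewise with $\ge$. *)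

theory Defs
  imports Main
begin

text \<open>
  Composition and the arrow maps of functors carry their objects as explicit arguments, and hom-sets
  need not be disjoint: an arrow \<open>X \<rightarrow> T Y\<close> of \<open>C\<close> does not determine \<open>Y\<close>, so it can be a Kleisli
  arrow \<open>X \<leadsto> Y\<close> for several \<open>Y\<close>. \<open>Comp C X Y Z g f\<close> is \<open>g \<circ> f\<close> for \<open>f : X \<rightarrow> Y\<close>, \<open>g : Y \<rightarrow> Z\<close>.
\<close>

record ('o, 'a) cat =
  Ob :: "'o set"
  Hom :: "'o \<Rightarrow> 'o \<Rightarrow> 'a set"
  Ident :: "'o \<Rightarrow> 'a"
  Comp :: "'o \<Rightarrow> 'o \<Rightarrow> 'o \<Rightarrow> 'a \<Rightarrow> 'a \<Rightarrow> 'a"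

locale category =
  fixes C :: "('o, 'a) cat"
  assumes Ident_in: "X \<in> Ob C \<Longrightarrow> Ident C X \<in> Hom C X X"
    and Comp_in: "\<lbrakk>X \<in> Ob C; Y \<in> Ob C; Z \<in> Ob C; f \<in> Hom C X Y; g \<in> Hom C Y Z\<rbrakk>
      \<Longrightarrow> Comp C X Y Z g f \<in> Hom C X Z"
    and Comp_Ident_left: "\<lbrakk>X \<in> Ob C; Y \<in> Ob C; f \<in> Hom C X Y\<rbrakk>
      \<Longrightarrow> Comp C X Y Y (Ident C Y) f = f"
    and Comp_Ident_right: "\<lbrakk>X \<in> Ob C; Y \<in> Ob C; f \<in> Hom C X Y\<rbrakk>
      \<Longrightarrow> Comp C X X Y f (Ident C X) = f"
    and Comp_assoc: "\<lbrakk>W \<in> Ob C; X \<in> Ob C; Y \<in> Ob C; Z \<in> Ob C;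
        f \<in> Hom C W X; g \<in> Hom C X Y; h \<in> Hom C Y Z\<rbrakk>
      \<Longrightarrow> Comp C W Y Z h (Comp C W X Y g f) = Comp C W X Z (Comp C X Y Z h g) f"

record ('o, 'a, 'p, 'b) functor_data =
  omap :: "'o \<Rightarrow> 'p"
  amap :: "'o \<Rightarrow> 'o \<Rightarrow> 'a \<Rightarrow> 'b"

locale cat_functor = source: category C + target: category D
  for C :: "('o, 'a) cat" and D :: "('p, 'b) cat" +
  fixes F :: "('o, 'a, 'p, 'b, 'z) functor_data_scheme"
  assumes omap_in: "X \<in> Ob C \<Longrightarrow> omap F X \<in> Ob D"
    and amap_in: "\<lbrakk>X \<in> Ob C; Y \<in> Ob C; f \<in> Hom C X Y\<rbrakk>
      \<Longrightarrow> amap F X Y f \<in> Hom D (omap F X) (omap F Y)"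
    and amap_Ident: "X \<in> Ob C \<Longrightarrow> amap F X X (Ident C X) = Ident D (omap F X)"
    and amap_Comp: "\<lbrakk>X \<in> Ob C; Y \<in> Ob C; Z \<in> Ob C; f \<in> Hom C X Y; g \<in> Hom C Y Z\<rbrakk>
      \<Longrightarrow> amap F X Z (Comp C X Y Z g f)
        = Comp D (omap F X) (omap F Y) (omap F Z) (amap F Y Z g) (amap F X Y f)"

definition id_functor :: "('o, 'a, 'o, 'a) functor_data" where
  "id_functor = \<lparr>omap = (\<lambda>X. X), amap = (\<lambda>X Y f. f)\<rparr>"

definition comp_functor ::
    "('p, 'b, 'q, 'c, 'y) functor_data_scheme \<Rightarrow> ('o, 'a, 'p, 'b, 'z) functor_data_scheme
      \<Rightarrow> ('o, 'a, 'q, 'c) functor_data" where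
  "comp_functor G F = \<lparr>omap = (\<lambda>X. omap G (omap F X)),
     amap = (\<lambda>X Y f. amap G (omap F X) (omap F Y) (amap F X Y f))\<rparr>"

definition nat_trans ::
    "('o, 'a) cat \<Rightarrow> ('p, 'b) cat \<Rightarrow> ('o, 'a, 'p, 'b, 'y) functor_data_scheme
      \<Rightarrow> ('o, 'a, 'p, 'b, 'z) functor_data_scheme \<Rightarrow> ('o \<Rightarrow> 'b) \<Rightarrow> bool" where
  "nat_trans C D F G t \<longleftrightarrow>
     (\<forall>X\<in>Ob C. t X \<in> Hom D (omap F X) (omap G X)) \<and>
     (\<forall>X\<in>Ob C. \<forall>Y\<in>Ob C. \<forall>f\<in>Hom C X Y.
        Comp D (omap F X) (omap F Y) (omap G Y) (t Y) (amap F X Y f)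
        = Comp D (omap F X) (omap G X) (omap G Y) (amap G X Y f) (t X))"

record ('o, 'a) monad_data = "('o, 'a, 'o, 'a) functor_data" +
  munit :: "'o \<Rightarrow> 'a"
  mmult :: "'o \<Rightarrow> 'a"

locale cat_monad = cat_functor C C M
  for C :: "('o, 'a) cat" and M :: "('o, 'a) monad_data" +
  assumes munit_natural: "nat_trans C C id_functor M (munit M)"
    and mmult_natural: "nat_trans C C (comp_functor M M) M (mmult M)"
    and mmult_munit: "X \<in> Ob C \<Longrightarrow>
      Comp C (omap M X) (omap M (omap M X)) (omap M X) (mmult M X) (munit M (omap M X))
      = Ident C (omap M X)"
    and mmult_amap_munit: "X \<in> Ob C \<Longrightarrow>
      Comp C (omap M X) (omap M (omap M X)) (omap M X) (mmult M X) (amap M X (omap M X) (munit M X))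
      = Ident C (omap M X)"
    and mmult_assoc: "X \<in> Ob C \<Longrightarrow>
      Comp C (omap M (omap M (omap M X))) (omap M (omap M X)) (omap M X)
        (mmult M X) (mmult M (omap M X))
      = Comp C (omap M (omap M (omap M X))) (omap M (omap M X)) (omap M X)
        (mmult M X) (amap M (omap M (omap M X)) (omap M X) (mmult M X))"

definition kleisli_ext ::
    "('o, 'a) cat \<Rightarrow> ('o, 'a) monad_data \<Rightarrow> 'o \<Rightarrow> 'o \<Rightarrow> 'a \<Rightarrow> 'a" where
  "kleisli_ext C M X Y f =
     Comp C (omap M X) (omap M (omap M Y)) (omap M Y) (mmult M Y) (amap M X (omap M Y) f)"

definition kleisli :: "('o, 'a) cat \<Rightarrow> ('o, 'a) monad_data \<Rightarrow> ('o, 'a) cat" where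
  "kleisli C M = \<lparr>Ob = Ob C, Hom = (\<lambda>X Y. Hom C X (omap M Y)), Ident = munit M,
     Comp = (\<lambda>X Y Z g f. Comp C X (omap M Y) (omap M Z) (kleisli_ext C M Y Z g) f)\<rparr>"

definition sharp :: "('o, 'a) cat \<Rightarrow> ('o, 'a) monad_data \<Rightarrow> 'o \<Rightarrow> 'o \<Rightarrow> 'a \<Rightarrow> 'a" where
  "sharp C M X Y f = Comp C X Y (omap M Y) (munit M Y) f"

definition lifts ::
    "('o, 'a) cat \<Rightarrow> ('o, 'a) monad_data \<Rightarrow> ('o, 'a, 'o, 'a, 'y) functor_data_scheme
      \<Rightarrow> ('o, 'a, 'o, 'a, 'z) functor_data_scheme \<Rightarrow> bool" where
  "lifts C T S S' \<longleftrightarrow>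
     cat_functor C C S \<and> cat_functor (kleisli C T) (kleisli C T) S' \<and>
     (\<forall>X\<in>Ob C. omap S' X = omap S X) \<and>
     (\<forall>X\<in>Ob C. \<forall>Y\<in>Ob C. \<forall>f\<in>Hom C X Y.
        amap S' X Y (sharp C T X Y f) = sharp C T (omap S X) (omap S Y) (amap S X Y f))"

record ('o, 'a, 'p, 'b) adjunction_data =
  ladj :: "('o, 'a, 'p, 'b) functor_data"
  radj :: "('p, 'b, 'o, 'a) functor_data"
  aunit :: "'o \<Rightarrow> 'a"
  acounit :: "'p \<Rightarrow> 'b"

text \<open>
  Only the data of an adjunction is recorded: the monad it induces depends on nothing else.
  The counit of the Kleisli adjunction at \<open>X\<close> is the identity of \<open>M X\<close> in \<open>C\<close>, read as a Kleisli arrow \<open>M X \<leadsto> X\<close>.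
\<close>

definition kleisli_adjunction ::
    "('o, 'a) cat \<Rightarrow> ('o, 'a) monad_data \<Rightarrow> ('o, 'a, 'o, 'a) adjunction_data" where
  "kleisli_adjunction C M = \<lparr>
     ladj = \<lparr>omap = (\<lambda>X. X), amap = sharp C M\<rparr>,
     radj = \<lparr>omap = omap M, amap = kleisli_ext C M\<rparr>,
     aunit = munit M,
     acounit = (\<lambda>X. Ident C (omap M X))\<rparr>"

text \<open>Composite of \<open>A : C \<rightleftharpoons> D\<close> and \<open>B : D \<rightleftharpoons> E\<close>.\<close>

definition comp_adjunction ::
    "('o, 'a) cat \<Rightarrow> ('q, 'c) cat \<Rightarrow> ('o, 'a, 'p, 'b) adjunction_data
      \<Rightarrow> ('p, 'b, 'q, 'c) adjunction_data \<Rightarrow> ('o, 'a, 'q, 'c) adjunction_data" where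
  "comp_adjunction C E A B = (
     let L = comp_functor (ladj B) (ladj A); R = comp_functor (radj A) (radj B) in
     \<lparr>ladj = L, radj = R,
      aunit = (\<lambda>X. let Y = omap (ladj A) X; Y' = omap (radj B) (omap (ladj B) Y) in
        Comp C X (omap (radj A) Y) (omap (radj A) Y') (amap (radj A) Y Y' (aunit B Y)) (aunit A X)),
      acounit = (\<lambda>Z. let Y = omap (radj B) Z; Y' = omap (ladj A) (omap (radj A) Y) in
        Comp E (omap (ladj B) Y') (omap (ladj B) Y) Z
          (acounit B Z) (amap (ladj B) Y' Y (acounit A Y)))\<rparr>)"

definition adjunction_monad :: "('o, 'a, 'p, 'b) adjunction_data \<Rightarrow> ('o, 'a) monad_data" where
  "adjunction_monad A = \<lparr>
     omap = (\<lambda>X. omap (radj A) (omap (ladj A) X)),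
     amap = amap (comp_functor (radj A) (ladj A)),
     munit = aunit A,
     mmult = (\<lambda>X. let Y = omap (ladj A) X in
       amap (radj A) (omap (ladj A) (omap (radj A) Y)) Y (acounit A Y))\<rparr>"

definition composite_monad ::
    "('o, 'a) cat \<Rightarrow> ('o, 'a) monad_data \<Rightarrow> ('o, 'a) monad_data \<Rightarrow> ('o, 'a) monad_data" where
  "composite_monad C T S' = adjunction_monad
     (comp_adjunction C (kleisli (kleisli C T) S')
        (kleisli_adjunction C T) (kleisli_adjunction (kleisli C T) S'))"

locale order_enriched = category K
  for K :: "('o, 'a) cat" +
  fixes le :: "'o \<Rightarrow> 'o \<Rightarrow> 'a \<Rightarrow> 'a \<Rightarrow> bool"
  assumes le_refl: "\<lbrakk>X \<in> Ob K; Y \<in> Ob K\<rbrakk> \<Longrightarrow> reflp_on (Hom K X Y) (le X Y)"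
    and le_trans: "\<lbrakk>X \<in> Ob K; Y \<in> Ob K\<rbrakk> \<Longrightarrow> transp_on (Hom K X Y) (le X Y)"
    and le_antisym: "\<lbrakk>X \<in> Ob K; Y \<in> Ob K\<rbrakk> \<Longrightarrow> antisymp_on (Hom K X Y) (le X Y)"
    and Comp_mono: "\<lbrakk>X \<in> Ob K; Y \<in> Ob K; Z \<in> Ob K;
        f \<in> Hom K X Y; f' \<in> Hom K X Y; g \<in> Hom K Y Z; g' \<in> Hom K Y Z;
        le X Y f f'; le Y Z g g'\<rbrakk>
      \<Longrightarrow> le X Z (Comp K X Y Z g f) (Comp K X Y Z g' f')"

definition locally_monotonic ::
    "('o, 'a) cat \<Rightarrow> ('o \<Rightarrow> 'o \<Rightarrow> 'a \<Rightarrow> 'a \<Rightarrow> bool)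
      \<Rightarrow> ('o, 'a, 'o, 'a, 'z) functor_data_scheme \<Rightarrow> bool" where
  "locally_monotonic K le F \<longleftrightarrow>
     (\<forall>X\<in>Ob K. \<forall>Y\<in>Ob K. \<forall>f\<in>Hom K X Y. \<forall>g\<in>Hom K X Y.
        le X Y f g \<longrightarrow> le (omap F X) (omap F Y) (amap F X Y f) (amap F X Y g))"

text \<open>\<open>st X \<alpha>\<close> is \<open>\<alpha>\<^sup>*\<close> for \<open>\<alpha> : X \<leadsto> X\<close>.\<close>

locale saturation =
  fixes C :: "('o, 'a) cat" and M :: "('o, 'a) monad_data"
    and le :: "'o \<Rightarrow> 'o \<Rightarrow> 'a \<Rightarrow> 'a \<Rightarrow> bool"
    and st :: "'o \<Rightarrow> 'a \<Rightarrow> 'a"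
  assumes st_in: "\<lbrakk>X \<in> Ob C; \<alpha> \<in> Hom (kleisli C M) X X\<rbrakk> \<Longrightarrow> st X \<alpha> \<in> Hom (kleisli C M) X X"
    and Ident_le_st: "\<lbrakk>X \<in> Ob C; \<alpha> \<in> Hom (kleisli C M) X X\<rbrakk>
      \<Longrightarrow> le X X (Ident (kleisli C M) X) (st X \<alpha>)"
    and le_st: "\<lbrakk>X \<in> Ob C; \<alpha> \<in> Hom (kleisli C M) X X\<rbrakk> \<Longrightarrow> le X X \<alpha> (st X \<alpha>)"
    and st_st_le: "\<lbrakk>X \<in> Ob C; \<alpha> \<in> Hom (kleisli C M) X X\<rbrakk>
      \<Longrightarrow> le X X (Comp (kleisli C M) X X X (st X \<alpha>) (st X \<alpha>)) (st X \<alpha>)"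
    and st_least: "\<lbrakk>X \<in> Ob C; \<alpha> \<in> Hom (kleisli C M) X X; \<beta> \<in> Hom (kleisli C M) X X;
        le X X (Ident (kleisli C M) X) \<beta>; le X X \<alpha> \<beta>;
        le X X (Comp (kleisli C M) X X X \<beta> \<beta>) \<beta>\<rbrakk>
      \<Longrightarrow> le X X (st X \<alpha>) \<beta>"
    and st_lax: "\<lbrakk>X \<in> Ob C; Y \<in> Ob C; f \<in> Hom C X Y;
        \<alpha> \<in> Hom (kleisli C M) X X; \<beta> \<in> Hom (kleisli C M) Y Y;
        le X Y (Comp (kleisli C M) X X Y (sharp C M X Y f) \<alpha>)
               (Comp (kleisli C M) X Y Y \<beta> (sharp C M X Y f))\<rbrakk>
      \<Longrightarrow> le X Y (Comp (kleisli C M) X X Y (sharp C M X Y f) (st X \<alpha>))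
                 (Comp (kleisli C M) X Y Y (st Y \<beta>) (sharp C M X Y f))"
    and st_oplax: "\<lbrakk>X \<in> Ob C; Y \<in> Ob C; f \<in> Hom C X Y;
        \<alpha> \<in> Hom (kleisli C M) X X; \<beta> \<in> Hom (kleisli C M) Y Y;
        le X Y (Comp (kleisli C M) X Y Y \<beta> (sharp C M X Y f))
               (Comp (kleisli C M) X X Y (sharp C M X Y f) \<alpha>)\<rbrakk>
      \<Longrightarrow> le X Y (Comp (kleisli C M) X Y Y (st Y \<beta>) (sharp C M X Y f))
                 (Comp (kleisli C M) X X Y (sharp C M X Y f) (st X \<alpha>))"

definition ordered_saturation_monad ::
    "('o, 'a) cat \<Rightarrow> ('o, 'a) monad_data \<Rightarrow> ('o \<Rightarrow> 'o \<Rightarrow> 'a \<Rightarrow> 'a \<Rightarrow> bool) \<Rightarrow> bool" where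
  "ordered_saturation_monad C M le \<longleftrightarrow>
     cat_monad C M \<and> order_enriched (kleisli C M) le \<and> (\<exists>st. saturation C M le st)"

lemma kleisli_simps [simp]:
  "Ob (kleisli C M) = Ob C"
  "Hom (kleisli C M) X Y = Hom C X (omap M Y)"
  "Ident (kleisli C M) X = munit M X"
  "Comp (kleisli C M) X Y Z g f = Comp C X (omap M Y) (omap M Z) (kleisli_ext C M Y Z g) f"
  by (simp_all add: kleisli_def)

context cat_monad
begin

lemma munit_in: "X \<in> Ob C \<Longrightarrow> munit M X \<in> Hom C X (omap M X)"
  using munit_natural by (simp add: nat_trans_def id_functor_def)

lemma mmult_in: "X \<in> Ob C \<Longrightarrow> mmult M X \<in> Hom C (omap M (omap M X)) (omap M X)"
  using mmult_natural by (simp add: nat_trans_def comp_functor_def)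

lemma munit_nat: "\<lbrakk>X \<in> Ob C; Y \<in> Ob C; f \<in> Hom C X Y\<rbrakk> \<Longrightarrow>
  Comp C X Y (omap M Y) (munit M Y) f = Comp C X (omap M X) (omap M Y) (amap M X Y f) (munit M X)"
  using munit_natural by (simp add: nat_trans_def id_functor_def)

lemma mmult_nat: "\<lbrakk>X \<in> Ob C; Y \<in> Ob C; f \<in> Hom C X Y\<rbrakk> \<Longrightarrow>
  Comp C (omap M (omap M X)) (omap M (omap M Y)) (omap M Y) (mmult M Y)
    (amap M (omap M X) (omap M Y) (amap M X Y f))
  = Comp C (omap M (omap M X)) (omap M X) (omap M Y) (amap M X Y f) (mmult M X)"
  using mmult_natural by (simp add: nat_trans_def comp_functor_def)

lemma kleisli_ext_in: "\<lbrakk>X \<in> Ob C; Y \<in> Ob C; f \<in> Hom C X (omap M Y)\<rbrakk> \<Longrightarrow>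
  kleisli_ext C M X Y f \<in> Hom C (omap M X) (omap M Y)"
  unfolding kleisli_ext_def
  by (rule source.Comp_in) (simp_all add: omap_in amap_in mmult_in)

lemma sharp_in: "\<lbrakk>X \<in> Ob C; Y \<in> Ob C; f \<in> Hom C X Y\<rbrakk> \<Longrightarrow> sharp C M X Y f \<in> Hom C X (omap M Y)"
  unfolding sharp_def by (rule source.Comp_in) (simp_all add: omap_in munit_in)

lemma kleisli_ext_munit: "X \<in> Ob C \<Longrightarrow> kleisli_ext C M X X (munit M X) = Ident C (omap M X)"
  by (simp add: kleisli_ext_def mmult_amap_munit)

lemma kleisli_ext_Comp_munit:
  assumes "X \<in> Ob C" "Y \<in> Ob C" "f \<in> Hom C X (omap M Y)"
  shows "Comp C X (omap M X) (omap M Y) (kleisli_ext C M X Y f) (munit M X) = f"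
proof -
  have "Comp C X (omap M X) (omap M Y) (kleisli_ext C M X Y f) (munit M X)
    = Comp C X (omap M (omap M Y)) (omap M Y) (mmult M Y)
        (Comp C X (omap M X) (omap M (omap M Y)) (amap M X (omap M Y) f) (munit M X))"
    unfolding kleisli_ext_def
    by (rule source.Comp_assoc[symmetric]) (simp_all add: assms omap_in amap_in mmult_in munit_in)
  also have "\<dots> = Comp C X (omap M (omap M Y)) (omap M Y) (mmult M Y)
        (Comp C X (omap M Y) (omap M (omap M Y)) (munit M (omap M Y)) f)"
    by (simp add: assms omap_in munit_nat)
  also have "\<dots> = Comp C X (omap M Y) (omap M Y)
      (Comp C (omap M Y) (omap M (omap M Y)) (omap M Y) (mmult M Y) (munit M (omap M Y))) f"
    by (rule source.Comp_assoc) (simp_all add: assms omap_in mmult_in munit_in)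
  also have "\<dots> = f"
    by (simp add: assms omap_in mmult_munit source.Comp_Ident_left)
  finally show ?thesis .
qed

lemma kleisli_ext_Comp:
  assumes "X \<in> Ob C" "Y \<in> Ob C" "Z \<in> Ob C" "f \<in> Hom C X (omap M Y)" "g \<in> Hom C Y (omap M Z)"
  shows "kleisli_ext C M X Z (Comp C X (omap M Y) (omap M Z) (kleisli_ext C M Y Z g) f)
    = Comp C (omap M X) (omap M Y) (omap M Z) (kleisli_ext C M Y Z g) (kleisli_ext C M X Y f)"
proof -
  let ?X = "omap M X" and ?Y = "omap M Y" and ?Z = "omap M Z"
  let ?Y2 = "omap M ?Y" and ?Z2 = "omap M ?Z" let ?Z3 = "omap M ?Z2"
  let ?f = "amap M X ?Y f" and ?g = "amap M Y ?Z g"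
  let ?gg = "amap M ?Y ?Z2 ?g"
  note [simp] = assms omap_in amap_in mmult_in munit_in
  have g2: "amap M ?Y ?Z (kleisli_ext C M Y Z g) = Comp C ?Y2 ?Z3 ?Z2 (amap M ?Z2 ?Z (mmult M Z)) ?gg"
    unfolding kleisli_ext_def by (rule amap_Comp) simp_all
  have "kleisli_ext C M X Z (Comp C X ?Y ?Z (kleisli_ext C M Y Z g) f)
    = Comp C ?X ?Z2 ?Z (mmult M Z) (Comp C ?X ?Y2 ?Z2 (amap M ?Y ?Z (kleisli_ext C M Y Z g)) ?f)"
    by (subst kleisli_ext_def) (simp add: amap_Comp kleisli_ext_in)
  also have "\<dots> = Comp C ?X ?Y2 ?Z
      (Comp C ?Y2 ?Z2 ?Z (mmult M Z) (amap M ?Y ?Z (kleisli_ext C M Y Z g))) ?f"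
    by (rule source.Comp_assoc) (simp_all add: kleisli_ext_in)
  also have "Comp C ?Y2 ?Z2 ?Z (mmult M Z) (amap M ?Y ?Z (kleisli_ext C M Y Z g))
    = Comp C ?Y2 ?Z3 ?Z (Comp C ?Z3 ?Z2 ?Z (mmult M Z) (amap M ?Z2 ?Z (mmult M Z))) ?gg"
    unfolding g2 by (rule source.Comp_assoc) simp_all
  also have "\<dots> = Comp C ?Y2 ?Z3 ?Z (Comp C ?Z3 ?Z2 ?Z (mmult M Z) (mmult M ?Z)) ?gg"
    by (simp add: mmult_assoc)
  also have "\<dots> = Comp C ?Y2 ?Z2 ?Z (mmult M Z) (Comp C ?Y2 ?Z3 ?Z2 (mmult M ?Z) ?gg)"
    by (rule source.Comp_assoc[symmetric]) simp_all
  also have "\<dots> = Comp C ?Y2 ?Z2 ?Z (mmult M Z) (Comp C ?Y2 ?Y ?Z2 ?g (mmult M Y))"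
    by (simp add: mmult_nat)
  also have "\<dots> = Comp C ?Y2 ?Y ?Z (kleisli_ext C M Y Z g) (mmult M Y)"
    unfolding kleisli_ext_def by (rule source.Comp_assoc) simp_all
  also have "Comp C ?X ?Y2 ?Z \<dots> ?f
    = Comp C ?X ?Y ?Z (kleisli_ext C M Y Z g) (kleisli_ext C M X Y f)"
    unfolding kleisli_ext_def[of C M X Y]
    by (rule source.Comp_assoc[symmetric]) (simp_all add: kleisli_ext_in)
  finally show ?thesis .
qed

lemma kleisli_ext_sharp:
  assumes "X \<in> Ob C" "Y \<in> Ob C" "f \<in> Hom C X Y"
  shows "kleisli_ext C M X Y (sharp C M X Y f) = amap M X Y f"
proof -
  note [simp] = assms omap_in amap_in mmult_in munit_in
  have "kleisli_ext C M X Y (sharp C M X Y f)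
    = Comp C (omap M X) (omap M (omap M Y)) (omap M Y) (mmult M Y)
        (Comp C (omap M X) (omap M Y) (omap M (omap M Y)) (amap M Y (omap M Y) (munit M Y)) (amap M X Y f))"
    by (simp add: kleisli_ext_def sharp_def amap_Comp)
  also have "\<dots> = Comp C (omap M X) (omap M Y) (omap M Y) (Comp C (omap M Y) (omap M (omap M Y)) (omap M Y)
      (mmult M Y) (amap M Y (omap M Y) (munit M Y))) (amap M X Y f)"
    by (rule source.Comp_assoc) simp_all
  also have "\<dots> = amap M X Y f"
    by (simp add: mmult_amap_munit source.Comp_Ident_left)
  finally show ?thesis .
qed

lemma kleisli_Comp_sharp:
  assumes "X \<in> Ob C" "Y \<in> Ob C" "Z \<in> Ob C" "f \<in> Hom C X Y" "g \<in> Hom C Y (omap M Z)"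
  shows "Comp (kleisli C M) X Y Z g (sharp C M X Y f) = Comp C X Y (omap M Z) g f"
proof -
  have "Comp (kleisli C M) X Y Z g (sharp C M X Y f)
    = Comp C X Y (omap M Z) (Comp C Y (omap M Y) (omap M Z) (kleisli_ext C M Y Z g) (munit M Y)) f"
    unfolding kleisli_simps sharp_def
    by (rule source.Comp_assoc) (simp_all add: assms omap_in munit_in kleisli_ext_in)
  then show ?thesis
    by (simp add: assms kleisli_ext_Comp_munit)
qed

lemma kleisli_category: "category (kleisli C M)"
proof
  fix W X Y Z f g h
  assume "W \<in> Ob (kleisli C M)" "X \<in> Ob (kleisli C M)" "Y \<in> Ob (kleisli C M)" "Z \<in> Ob (kleisli C M)"
    "f \<in> Hom (kleisli C M) W X" "g \<in> Hom (kleisli C M) X Y" "h \<in> Hom (kleisli C M) Y Z"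
  then have [simp]: "W \<in> Ob C" "X \<in> Ob C" "Y \<in> Ob C" "Z \<in> Ob C"
    "f \<in> Hom C W (omap M X)" "g \<in> Hom C X (omap M Y)" "h \<in> Hom C Y (omap M Z)"
    by simp_all
  show "Comp (kleisli C M) W Y Z h (Comp (kleisli C M) W X Y g f)
      = Comp (kleisli C M) W X Z (Comp (kleisli C M) X Y Z h g) f"
    by (simp add: kleisli_ext_Comp, rule source.Comp_assoc) (simp_all add: omap_in kleisli_ext_in)
qed (auto simp: munit_in kleisli_ext_munit source.Comp_Ident_left omap_in kleisli_ext_Comp_munit
      intro!: source.Comp_in kleisli_ext_in)

end

lemma composite_monad_omap [simp]:
  "omap (composite_monad C T S') X = omap T (omap S' X)"
  by (simp add: composite_monad_def adjunction_monad_def comp_adjunction_def comp_functor_def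
      kleisli_adjunction_def Let_def)

lemma composite_monad_amap':
  "amap (composite_monad C T S') X Y f
   = kleisli_ext C T (omap S' X) (omap S' Y)
       (kleisli_ext (kleisli C T) S' X Y (sharp (kleisli C T) S' X Y (sharp C T X Y f)))"
  by (simp add: composite_monad_def adjunction_monad_def comp_adjunction_def comp_functor_def
      kleisli_adjunction_def Let_def)

context
  fixes C :: "('o, 'a) cat" and T S' :: "('o, 'a) monad_data"
  assumes T: "cat_monad C T" and S': "cat_monad (kleisli C T) S'"
begin

interpretation T: cat_monad C T by (rule T)
interpretation S': cat_monad "kleisli C T" S' by (rule S')

lemma composite_monad_amap:
  assumes "lifts C T S S'" "X \<in> Ob C" "Y \<in> Ob C" "f \<in> Hom C X Y"
  shows "amap (composite_monad C T S') X Y f = amap T (omap S X) (omap S Y) (amap S X Y f)"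
proof -
  interpret S: cat_functor C C S using assms(1) by (simp add: lifts_def)
  show ?thesis
    using assms S'.kleisli_ext_sharp[of X Y "sharp C T X Y f"]
    by (simp add: composite_monad_amap' T.sharp_in lifts_def T.kleisli_ext_sharp S.omap_in S.amap_in)
qed

lemma composite_monad_munit:
  assumes "X \<in> Ob C"
  shows "munit (composite_monad C T S') X = munit S' X"
  using assms S'.omap_in[of X] S'.munit_in[of X]
  by (simp add: composite_monad_def adjunction_monad_def comp_adjunction_def comp_functor_def
      kleisli_adjunction_def Let_def T.kleisli_ext_Comp_munit)

lemma composite_monad_mmult:
  assumes "X \<in> Ob C"
  shows "mmult (composite_monad C T S') X
    = kleisli_ext C T (omap S' (omap T (omap S' X))) (omap S' X)
        (kleisli_ext (kleisli C T) S' (omap T (omap S' X)) X (Ident C (omap T (omap S' X))))"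
proof -
  let ?SX = "omap S' X" let ?TSX = "omap T ?SX"
  have SX [simp]: "?SX \<in> Ob C" using S'.omap_in[of X] assms by simp
  have TSX [simp]: "?TSX \<in> Ob C" by (simp add: T.omap_in)
  have id: "Ident C ?TSX \<in> Hom (kleisli C T) ?TSX ?SX" by (simp add: T.source.Ident_in)
  have idS: "Ident (kleisli C T) ?SX \<in> Hom (kleisli C T) ?SX ?SX"
    by (rule S'.source.Ident_in) simp
  have "Comp (kleisli (kleisli C T) S') ?TSX ?SX X (Ident (kleisli C T) ?SX)
      (sharp (kleisli C T) S' ?TSX ?SX (Ident C ?TSX)) = Ident C ?TSX"
    by (subst S'.kleisli_Comp_sharp) (use id idS assms in \<open>simp_all only: S'.source.Comp_Ident_left
      kleisli_simps(1) SX TSX\<close>)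
  then show ?thesis
    by (simp only: composite_monad_def adjunction_monad_def comp_adjunction_def comp_functor_def
      kleisli_adjunction_def Let_def functor_data.simps adjunction_data.simps monad_data.simps)
qed

text \<open>
  The Kleisli category of the composite monad is that of \<open>S'\<close> on \<open>kleisli C T\<close>, and an arrow \<open>f\<close>
  of \<open>C\<close> induces \<open>e\<^sub>Y \<cdot> f\<^sup>\<sharp>\<close> in it.
\<close>

lemma kleisli_composite_Hom:
  "Hom (kleisli C (composite_monad C T S')) X Y = Hom (kleisli C T) X (omap S' Y)"
  by simp

lemma kleisli_composite_Ident:
  "X \<in> Ob C \<Longrightarrow> Ident (kleisli C (composite_monad C T S')) X = munit S' X"
  by (simp add: composite_monad_munit)

lemma kleisli_composite_sharp:
  assumes "X \<in> Ob C" "Y \<in> Ob C" "f \<in> Hom C X Y"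
  shows "sharp C (composite_monad C T S') X Y f
    = Comp (kleisli C T) X Y (omap S' Y) (munit S' Y) (sharp C T X Y f)"
  using assms S'.omap_in[of Y] S'.munit_in[of Y] T.kleisli_Comp_sharp[of X Y "omap S' Y" f "munit S' Y"]
  by (simp add: sharp_def composite_monad_munit)

lemma kleisli_composite_Comp:
  assumes "X \<in> Ob C" "Y \<in> Ob C" "Z \<in> Ob C"
    and "f \<in> Hom (kleisli C T) X (omap S' Y)" "g \<in> Hom (kleisli C T) Y (omap S' Z)"
  shows "Comp (kleisli C (composite_monad C T S')) X Y Z g f
    = Comp (kleisli C T) X (omap S' Y) (omap S' Z)
        (Comp (kleisli C T) (omap S' Y) (omap S' (omap S' Z)) (omap S' Z)
          (mmult S' Z) (amap S' Y (omap S' Z) g)) f"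
proof -
  let ?K = "kleisli C T" let ?SY = "omap S' Y" and ?SZ = "omap S' Z" let ?TSZ = "omap T ?SZ"
  let ?i = "Ident C ?TSZ" and ?g = "sharp C T Y ?TSZ g"
  let ?h = "sharp ?K S' Y ?TSZ ?g"
  have SZ: "?SZ \<in> Ob C" "?SY \<in> Ob C" using S'.omap_in[of Z] S'.omap_in[of Y] assms by simp_all
  have TSZ: "?TSZ \<in> Ob C" using SZ by (simp add: T.omap_in)
  have STSZ: "omap S' ?TSZ \<in> Ob C" using S'.omap_in[of ?TSZ] TSZ by simp
  have i: "?i \<in> Hom ?K ?TSZ ?SZ" using TSZ by (simp add: T.source.Ident_in)
  have gC: "g \<in> Hom C Y ?TSZ" using assms by simp
  have g: "?g \<in> Hom ?K Y ?TSZ" using T.sharp_in[OF assms(2) TSZ gC] by simp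
  have h: "?h \<in> Hom ?K Y (omap S' ?TSZ)" using S'.sharp_in[of Y ?TSZ ?g] assms TSZ g by simp
  have ih: "Comp ?K Y (omap S' ?TSZ) ?SZ (kleisli_ext ?K S' ?TSZ Z ?i) ?h = g"
  proof -
    have "Comp ?K Y (omap S' ?TSZ) ?SZ (kleisli_ext ?K S' ?TSZ Z ?i) ?h = Comp ?K Y ?TSZ ?SZ ?i ?g"
      using S'.kleisli_Comp_sharp[of Y ?TSZ Z ?g ?i] assms TSZ g i by (simp add: kleisli_simps(4)[of ?K])
    also have "\<dots> = Comp C Y ?TSZ ?TSZ ?i g"
      by (rule T.kleisli_Comp_sharp) (use assms TSZ SZ gC i in simp_all)
    also have "\<dots> = g" using assms TSZ gC by (simp add: T.source.Comp_Ident_left)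
    finally show ?thesis .
  qed
  have "kleisli_ext C (composite_monad C T S') Y Z g
    = Comp C (omap T ?SY) (omap T (omap S' ?TSZ)) ?TSZ
       (kleisli_ext C T (omap S' ?TSZ) ?SZ (kleisli_ext ?K S' ?TSZ Z ?i))
       (kleisli_ext C T ?SY (omap S' ?TSZ) (kleisli_ext ?K S' Y ?TSZ ?h))"
    unfolding kleisli_ext_def[of C "composite_monad C T S'"] composite_monad_mmult[OF assms(3)]
      composite_monad_amap' composite_monad_omap ..
  also have "\<dots> = kleisli_ext C T ?SY ?SZ (Comp ?K ?SY (omap S' ?TSZ) ?SZ
      (kleisli_ext ?K S' ?TSZ Z ?i) (kleisli_ext ?K S' Y ?TSZ ?h))"
    using T.kleisli_ext_Comp[of ?SY "omap S' ?TSZ" ?SZ "kleisli_ext ?K S' Y ?TSZ ?h" "kleisli_ext ?K S' ?TSZ Z ?i"]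
      SZ STSZ S'.kleisli_ext_in[of Y ?TSZ ?h] S'.kleisli_ext_in[of ?TSZ Z ?i] assms TSZ h i
    by simp
  also have "Comp ?K ?SY (omap S' ?TSZ) ?SZ
      (kleisli_ext ?K S' ?TSZ Z ?i) (kleisli_ext ?K S' Y ?TSZ ?h) = kleisli_ext ?K S' Y Z g"
    using S'.kleisli_ext_Comp[of Y ?TSZ Z ?h ?i] assms TSZ h i unfolding ih by simp
  finally show ?thesis
    by (simp add: kleisli_ext_def[of ?K S'])
qed

end

end

theory Submission
  imports Defs
begin

text \<open>
  Write \<open>\<alpha>\<^sup>\<dagger> = m \<cdot> S\<alpha>\<close> for the extension of \<open>\<alpha> : X \<leadsto> S X\<close>. The saturation of the composite monad is
  \<open>(\<alpha>\<^sup>\<dagger>)\<^sup>* \<cdot> e\<close>; the equation assumed in the theorem says that its extension is again \<open>(\<alpha>\<^sup>\<dagger>)\<^sup>*\<close>. Since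
  extension is monotone and turns Kleisli composition into composition, the saturation axioms for
  \<open>\<alpha>\<close> follow from those for \<open>\<alpha>\<^sup>\<dagger>\<close>. The lax conditions transfer because extending both
  sides of an inequality over \<open>f\<close> gives an inequality over \<open>S f\<close>, which is again induced by an arrow
  of the base category as \<open>S\<close> lifts.
\<close>

section \<open>Monads from Kleisli extensions\<close>

text \<open>The Kleisli triple presentation: three laws of an extension operator \<open>E\<close>
  yield functoriality, naturality and the monad laws, provided \<open>amap\<close> and
  \<open>mmult\<close> are the ones that \<open>E\<close> determines. For the composite monad these
  three laws are much easier to check than the laws of its multiplication.\<close>

lemma cat_monad_of_extension:
  assumes "category C"
    and omap_in: "\<And>X. X \<in> Ob C \<Longrightarrow> omap M X \<in> Ob C"
    and munit_in: "\<And>X. X \<in> Ob C \<Longrightarrow> munit M X \<in> Hom C X (omap M X)"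
    and E_in: "\<And>X Y f. \<lbrakk>X \<in> Ob C; Y \<in> Ob C; f \<in> Hom C X (omap M Y)\<rbrakk> \<Longrightarrow>
      E X Y f \<in> Hom C (omap M X) (omap M Y)"
    and E_munit: "\<And>X. X \<in> Ob C \<Longrightarrow> E X X (munit M X) = Ident C (omap M X)"
    and E_Comp_munit: "\<And>X Y f. \<lbrakk>X \<in> Ob C; Y \<in> Ob C; f \<in> Hom C X (omap M Y)\<rbrakk> \<Longrightarrow>
      Comp C X (omap M X) (omap M Y) (E X Y f) (munit M X) = f"
    and E_Comp: "\<And>X Y Z f g. \<lbrakk>X \<in> Ob C; Y \<in> Ob C; Z \<in> Ob C;
        f \<in> Hom C X (omap M Y); g \<in> Hom C Y (omap M Z)\<rbrakk> \<Longrightarrow>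
      E X Z (Comp C X (omap M Y) (omap M Z) (E Y Z g) f)
      = Comp C (omap M X) (omap M Y) (omap M Z) (E Y Z g) (E X Y f)"
    and amap: "\<And>X Y f. \<lbrakk>X \<in> Ob C; Y \<in> Ob C; f \<in> Hom C X Y\<rbrakk> \<Longrightarrow>
      amap M X Y f = E X Y (Comp C X Y (omap M Y) (munit M Y) f)"
    and mmult: "\<And>X. X \<in> Ob C \<Longrightarrow> mmult M X = E (omap M X) X (Ident C (omap M X))"
  shows "cat_monad C M"
proof -
  interpret category C by fact
  note [simp] = omap_in munit_in E_in Ident_in Comp_in
  \<comment> \<open>Fusion: \<open>amap\<close> is the extension of \<open>munit\<close> after
    \<open>f\<close>, and \<open>E_Comp_munit\<close> cancels that unit. With
    \<open>amap_Comp_E\<close>, the mirror image, it reduces the remaining laws to identities in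
    \<open>C\<close>.\<close>
  have E_Comp_amap: "Comp C (omap M X) (omap M Y) (omap M Z) (E Y Z g) (amap M X Y f)
      = E X Z (Comp C X Y (omap M Z) g f)"
    if "X \<in> Ob C" "Y \<in> Ob C" "Z \<in> Ob C" "f \<in> Hom C X Y" "g \<in> Hom C Y (omap M Z)" for X Y Z f g
  proof -
    have "Comp C X (omap M Y) (omap M Z) (E Y Z g) (Comp C X Y (omap M Y) (munit M Y) f)
        = Comp C X Y (omap M Z) g f"
      using that by (subst Comp_assoc) (simp_all add: E_Comp_munit)
    then show ?thesis
      using that E_Comp[of X Y Z "Comp C X Y (omap M Y) (munit M Y) f" g] by (simp add: amap)
  qed
  have amap_Comp_E: "Comp C (omap M X) (omap M Y) (omap M Z) (amap M Y Z g) (E X Y f)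
      = E X Z (Comp C X (omap M Y) (omap M Z) (amap M Y Z g) f)"
    if "X \<in> Ob C" "Y \<in> Ob C" "Z \<in> Ob C" "f \<in> Hom C X (omap M Y)" "g \<in> Hom C Y Z" for X Y Z f g
    using that by (simp add: amap E_Comp)
  have amap_in: "amap M X Y f \<in> Hom C (omap M X) (omap M Y)"
    if "X \<in> Ob C" "Y \<in> Ob C" "f \<in> Hom C X Y" for X Y f
    using that by (simp add: amap)
  have mmult_in: "mmult M X \<in> Hom C (omap M (omap M X)) (omap M X)" if "X \<in> Ob C" for X
    using that by (simp add: mmult)
  show ?thesis
  proof
    fix X assume [simp]: "X \<in> Ob C"
    show "amap M X X (Ident C X) = Ident C (omap M X)"
      using Comp_Ident_right[of X "omap M X" "munit M X"] by (simp add: amap E_munit)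
    show "Comp C (omap M X) (omap M (omap M X)) (omap M X) (mmult M X) (munit M (omap M X))
        = Ident C (omap M X)"
      by (simp add: mmult E_Comp_munit)
    show "Comp C (omap M X) (omap M (omap M X)) (omap M X) (mmult M X)
        (amap M X (omap M X) (munit M X)) = Ident C (omap M X)"
      by (simp add: mmult E_Comp_amap Comp_Ident_left E_munit)
    show "Comp C (omap M (omap M (omap M X))) (omap M (omap M X)) (omap M X)
        (mmult M X) (mmult M (omap M X))
      = Comp C (omap M (omap M (omap M X))) (omap M (omap M X)) (omap M X)
        (mmult M X) (amap M (omap M (omap M X)) (omap M X) (mmult M X))"
      \<comment> \<open>Both sides equal the extension of \<open>mmult M X\<close>. For the left one
        this is \<open>E_Comp\<close> at two identities, whose extensions are the two
        multiplications.\<close>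
      using E_Comp[of "omap M (omap M X)" "omap M X" X
          "Ident C (omap M (omap M X))" "Ident C (omap M X)"]
      by (simp add: mmult E_Comp_amap Comp_Ident_left Comp_Ident_right)
  next
    fix X Y Z f g
    assume [simp]: "X \<in> Ob C" "Y \<in> Ob C" "Z \<in> Ob C" "f \<in> Hom C X Y" "g \<in> Hom C Y Z"
    have "Comp C (omap M X) (omap M Y) (omap M Z) (amap M Y Z g) (amap M X Y f)
        = E X Z (Comp C X Y (omap M Z) (Comp C Y Z (omap M Z) (munit M Z) g) f)"
      by (subst amap[of Y Z g]) (simp_all add: E_Comp_amap)
    also have "\<dots> = amap M X Z (Comp C X Y Z g f)"
      by (simp add: amap Comp_assoc)
    finally show "amap M X Z (Comp C X Y Z g f)
        = Comp C (omap M X) (omap M Y) (omap M Z) (amap M Y Z g) (amap M X Y f)" ..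
  next
    show "nat_trans C C id_functor M (munit M)"
      by (simp add: nat_trans_def id_functor_def amap E_Comp_munit)
    \<comment> \<open>Both composites of the naturality square are the extension of
      \<open>amap M X Y f\<close>.\<close>
    show "nat_trans C C (comp_functor M M) M (mmult M)"
      by (simp add: nat_trans_def comp_functor_def mmult E_Comp_amap amap_Comp_E amap_in
          Comp_Ident_left Comp_Ident_right)
  qed (simp_all add: amap_in)
qed

text \<open>The extension of the composite monad is extension along \<open>S'\<close> followed by
  extension along \<open>T\<close>. Each law is that of \<open>S'\<close>, stated in the Kleisli
  category of \<open>T\<close>, transported to \<open>C\<close> by the same law of
  \<open>T\<close>.\<close>

lemma composite_cat_monad:
  assumes "cat_monad C T" "cat_monad (kleisli C T) S'"
  shows "cat_monad C (composite_monad C T S')"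
proof -
  interpret T: cat_monad C T by fact
  interpret S': cat_monad "kleisli C T" S' by fact
  note [simp] = composite_monad_munit[OF assms]
  have [simp]: "omap S' X \<in> Ob C" if "X \<in> Ob C" for X
    using S'.omap_in[of X] that by simp
  have [simp]: "munit S' X \<in> Hom C X (omap T (omap S' X))" if "X \<in> Ob C" for X
    using S'.munit_in[of X] that by simp
  have [simp]: "kleisli_ext (kleisli C T) S' X Y f \<in> Hom C (omap S' X) (omap T (omap S' Y))"
    if "X \<in> Ob C" "Y \<in> Ob C" "f \<in> Hom C X (omap T (omap S' Y))" for X Y f
    using S'.kleisli_ext_in[of X Y f] that by simp
  show ?thesis
  proof (rule cat_monad_of_extension[where E = "\<lambda>X Y f. kleisli_ext C T (omap S' X) (omap S' Y)
        (kleisli_ext (kleisli C T) S' X Y f)"])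
    fix X Y f assume "X \<in> Ob C" "Y \<in> Ob C" "f \<in> Hom C X Y"
    then show "amap (composite_monad C T S') X Y f = kleisli_ext C T (omap S' X) (omap S' Y)
        (kleisli_ext (kleisli C T) S' X Y (Comp C X Y (omap (composite_monad C T S') Y)
          (munit (composite_monad C T S') Y) f))"
      using kleisli_composite_sharp[OF assms, of X Y f]
      by (simp add: composite_monad_amap' sharp_def)
  next
    fix X assume "X \<in> Ob C"
    then show "kleisli_ext C T (omap S' X) (omap S' X)
        (kleisli_ext (kleisli C T) S' X X (munit (composite_monad C T S') X))
        = Ident C (omap (composite_monad C T S') X)"
      using S'.kleisli_ext_munit[of X] by (simp add: T.kleisli_ext_munit)
  next
    fix X Y f assume "X \<in> Ob C" "Y \<in> Ob C" "f \<in> Hom C X (omap (composite_monad C T S') Y)"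
    then show "Comp C X (omap (composite_monad C T S') X) (omap (composite_monad C T S') Y)
        (kleisli_ext C T (omap S' X) (omap S' Y) (kleisli_ext (kleisli C T) S' X Y f))
        (munit (composite_monad C T S') X) = f"
      using S'.kleisli_ext_Comp_munit[of X Y f] by simp
  next
    fix X Y Z f g
    assume "X \<in> Ob C" "Y \<in> Ob C" "Z \<in> Ob C"
      "f \<in> Hom C X (omap (composite_monad C T S') Y)"
      "g \<in> Hom C Y (omap (composite_monad C T S') Z)"
    \<comment> \<open>The inner composite is a composite in the Kleisli category of
      \<open>T\<close>. Extension along \<open>S'\<close> preserves it, and extension along
      \<open>T\<close> turns the result into a composite in \<open>C\<close>.\<close>
    then show "kleisli_ext C T (omap S' X) (omap S' Z) (kleisli_ext (kleisli C T) S' X Z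
        (Comp C X (omap (composite_monad C T S') Y) (omap (composite_monad C T S') Z)
          (kleisli_ext C T (omap S' Y) (omap S' Z) (kleisli_ext (kleisli C T) S' Y Z g)) f))
      = Comp C (omap (composite_monad C T S') X) (omap (composite_monad C T S') Y)
          (omap (composite_monad C T S') Z)
          (kleisli_ext C T (omap S' Y) (omap S' Z) (kleisli_ext (kleisli C T) S' Y Z g))
          (kleisli_ext C T (omap S' X) (omap S' Y) (kleisli_ext (kleisli C T) S' X Y f))"
      using S'.kleisli_ext_Comp[of X Y Z f g] by (simp add: T.kleisli_ext_Comp)
  qed (simp_all add: T.source.category_axioms T.omap_in T.kleisli_ext_in
      composite_monad_mmult[OF assms])
qed

section \<open>Extension, base arrows and the order\<close>

text \<open>\<open>amap\<close> is the extension of \<open>sharp\<close>, so this is an instance of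
  \<open>kleisli_ext_Comp\<close>. Together with its companion for precomposition it carries an
  inequality over f to one over S f.\<close>

lemma (in cat_monad) kleisli_ext_Comp_amap:
  assumes "X \<in> Ob C" "Y \<in> Ob C" "Z \<in> Ob C" "f \<in> Hom C X (omap M Y)" "g \<in> Hom C Y Z"
  shows "kleisli_ext C M X Z (Comp C X (omap M Y) (omap M Z) (amap M Y Z g) f)
    = Comp C (omap M X) (omap M Y) (omap M Z) (amap M Y Z g) (kleisli_ext C M X Y f)"
  using kleisli_ext_Comp[of X Y Z f "sharp C M Y Z g"] assms
  by (simp add: kleisli_ext_sharp sharp_in)

lemma (in cat_monad) kleisli_ext_Comp_base:
  assumes "X \<in> Ob C" "Y \<in> Ob C" "Z \<in> Ob C" "f \<in> Hom C X Y" "g \<in> Hom C Y (omap M Z)"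
  shows "kleisli_ext C M X Z (Comp C X Y (omap M Z) g f)
    = Comp C (omap M X) (omap M Y) (omap M Z) (kleisli_ext C M Y Z g) (amap M X Y f)"
  using kleisli_ext_Comp[of X Y Z "sharp C M X Y f" g] kleisli_Comp_sharp[of X Y Z f g] assms
  by (simp add: kleisli_ext_sharp sharp_in)

text \<open>Local monotonicity handles \<open>amap\<close>; composing with the multiplication is
  monotone because the order is reflexive at \<open>mmult\<close>.\<close>

lemma kleisli_ext_mono:
  assumes "cat_monad K M" "order_enriched K le" "locally_monotonic K le M"
    and "X \<in> Ob K" "Y \<in> Ob K" "f \<in> Hom K X (omap M Y)" "g \<in> Hom K X (omap M Y)"
    and "le X (omap M Y) f g"
  shows "le (omap M X) (omap M Y) (kleisli_ext K M X Y f) (kleisli_ext K M X Y g)"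
proof -
  interpret order_enriched K le by fact
  interpret M: cat_monad K M by fact
  note [simp] = assms(4-8) M.omap_in M.amap_in M.mmult_in
  have "le (omap M X) (omap M (omap M Y)) (amap M X (omap M Y) f) (amap M X (omap M Y) g)"
    using assms by (simp add: locally_monotonic_def)
  moreover have "le (omap M (omap M Y)) (omap M Y) (mmult M Y) (mmult M Y)"
    using le_refl[of "omap M (omap M Y)" "omap M Y"] by (simp add: reflp_on_def)
  ultimately show ?thesis
    unfolding kleisli_ext_def by (intro Comp_mono) simp_all
qed

section \<open>The saturation axioms for the composite monad\<close>

theorem theorem5p8:
  fixes C :: "('o, 'a) cat"
    and T :: "('o, 'a) monad_data"
    and le :: "'o \<Rightarrow> 'o \<Rightarrow> 'a \<Rightarrow> 'a \<Rightarrow> bool"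
    and star :: "'o \<Rightarrow> 'a \<Rightarrow> 'a"
    and S :: "('o, 'a, 'o, 'a) functor_data"
    and S' :: "('o, 'a) monad_data"
  assumes "ordered_saturation_monad C T le"
    and "saturation C T le star"
    and "lifts C T S S'"
    and "cat_monad (kleisli C T) S'"
    and "locally_monotonic (kleisli C T) le S'"
    and "\<And>X \<alpha>. \<lbrakk>X \<in> Ob C; \<alpha> \<in> Hom (kleisli C T) X (omap S' X)\<rbrakk> \<Longrightarrow>
      (let K = kleisli C T; SX = omap S' X; SSX = omap S' SX; m = mmult S' X; e = munit S' X;
           sat = star SX (Comp K SX SSX SX m (amap S' X SX \<alpha>))
       in Comp K SX SSX SX m (amap S' X SX (Comp K X SX SX sat e)) = sat)"
  shows "ordered_saturation_monad C (composite_monad C T S') (\<lambda>X Y. le X (omap S' Y))"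
proof -
  define K where "K = kleisli C T"
  let ?TS = "composite_monad C T S'"
  let ?L = "kleisli C ?TS"
  let ?E = "kleisli_ext K S'"
  let ?e = "munit S'"
  let ?S = "omap S'"
  have T: "cat_monad C T" and K: "order_enriched K le"
    using assms(1) by (simp_all add: ordered_saturation_monad_def K_def)
  interpret T: cat_monad C T by (rule T)
  interpret star: saturation C T le star by fact
  interpret K: order_enriched K le by (rule K)
  have S': "cat_monad K S'" unfolding K_def by fact
  interpret M: cat_monad K S' by (rule S')
  have lm: "locally_monotonic K le S'" unfolding K_def by fact
  have Ob [simp]: "Ob K = Ob C" by (simp add: K_def)
  \<comment> \<open>From here on the Kleisli category \<open>?L\<close> of the composite is read
    inside \<open>K\<close>: its arrows from X to Y are arrows from X to S Y, and g after f is
    \<open>?E Y Z g\<close> composed with f.\<close>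
  have Ob_L: "Ob ?L = Ob C" by simp
  have Hom_L: "Hom ?L X Y = Hom K X (?S Y)" for X Y by (simp add: K_def)
  have Ident_L: "Ident ?L X = ?e X" if "X \<in> Ob C" for X
    using that assms(4) T by (simp add: composite_monad_munit)
  have Comp_L: "Comp ?L X Y Z g f = Comp K X (?S Y) (?S Z) (?E Y Z g) f"
    if "X \<in> Ob C" "Y \<in> Ob C" "Z \<in> Ob C" "f \<in> Hom K X (?S Y)" "g \<in> Hom K Y (?S Z)" for X Y Z f g
    using kleisli_composite_Comp[OF T assms(4), of X Y Z f g] that
    unfolding K_def[symmetric] kleisli_ext_def by simp
  have sharp_L: "sharp C ?TS X Y f = sharp K S' X Y (sharp C T X Y f)"
    if "X \<in> Ob C" "Y \<in> Ob C" "f \<in> Hom C X Y" for X Y f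
    using kleisli_composite_sharp[OF T assms(4) that] by (simp only: sharp_def[of "kleisli C T"] K_def)
  have [simp]: "?S X \<in> Ob C" if "X \<in> Ob C" for X using M.omap_in[of X] that by simp
  have [simp]: "?e X \<in> Hom K X (?S X)" if "X \<in> Ob C" for X using M.munit_in[of X] that by simp
  have E_in [simp]: "?E X Y f \<in> Hom K (?S X) (?S Y)"
    if "X \<in> Ob C" "Y \<in> Ob C" "f \<in> Hom K X (?S Y)" for X Y f
    using M.kleisli_ext_in[of X Y f] that by simp
  have sharp_in [simp]: "sharp C T X Y f \<in> Hom K X Y"
    if "X \<in> Ob C" "Y \<in> Ob C" "f \<in> Hom C X Y" for X Y f
    using T.sharp_in[OF that] by (simp add: K_def)
  have E_mono: "le (?S X) (?S Y) (?E X Y f) (?E X Y g)"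
    if "X \<in> Ob C" "Y \<in> Ob C" "f \<in> Hom K X (?S Y)" "g \<in> Hom K X (?S Y)" "le X (?S Y) f g" for X Y f g
    using kleisli_ext_mono[OF S' K lm, of X Y f g] that by simp
  have refl: "le X Y f f" if "X \<in> Ob C" "Y \<in> Ob C" "f \<in> Hom K X Y" for X Y f
    using K.le_refl[of X Y] that by (simp add: reflp_on_def)
  have Comp_right_mono: "le X Z (Comp K X Y Z g f) (Comp K X Y Z g' f)"
    if "X \<in> Ob C" "Y \<in> Ob C" "Z \<in> Ob C" "f \<in> Hom K X Y" "g \<in> Hom K Y Z" "g' \<in> Hom K Y Z"
      "le Y Z g g'" for X Y Z f g g'
    using that by (intro K.Comp_mono) (simp_all add: refl)
  have TS: "cat_monad C ?TS" using T assms(4) by (rule composite_cat_monad)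
  then have L: "category ?L" by (rule cat_monad.kleisli_category)

  \<comment> \<open>The hom-set orders are those of \<open>K\<close>. Monotonicity of composition
    needs in addition that extension is monotone in the left factor.\<close>
  have "order_enriched ?L (\<lambda>X Y. le X (?S Y))"
  proof (intro order_enriched.intro L order_enriched_axioms.intro)
    fix X Y assume *: "X \<in> Ob ?L" "Y \<in> Ob ?L"
    show "reflp_on (Hom ?L X Y) (le X (?S Y))"
      unfolding Hom_L using * by (intro K.le_refl) simp_all
    show "transp_on (Hom ?L X Y) (le X (?S Y))"
      unfolding Hom_L using * by (intro K.le_trans) simp_all
    show "antisymp_on (Hom ?L X Y) (le X (?S Y))"
      unfolding Hom_L using * by (intro K.le_antisym) simp_all
  next
    fix X Y Z f f' g g'
    assume "X \<in> Ob ?L" "Y \<in> Ob ?L" "Z \<in> Ob ?L"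
      "f \<in> Hom ?L X Y" "f' \<in> Hom ?L X Y" "g \<in> Hom ?L Y Z" "g' \<in> Hom ?L Y Z"
      "le X (?S Y) f f'" "le Y (?S Z) g g'"
    then show "le X (?S Z) (Comp ?L X Y Z g f) (Comp ?L X Y Z g' f')"
      unfolding Hom_L Ob_L by (simp only: Comp_L) (intro K.Comp_mono, simp_all add: E_mono)
  qed

  moreover
  define sat where "sat X \<alpha> = star (?S X) (?E X X \<alpha>)" for X \<alpha>
  define st where "st X \<alpha> = Comp K X (?S X) (?S X) (sat X \<alpha>) (?e X)" for X \<alpha>
  have "saturation C ?TS (\<lambda>X Y. le X (?S Y)) st"
  proof -
    have sat_in [simp]: "sat X \<alpha> \<in> Hom K (?S X) (?S X)"
      if "X \<in> Ob C" "\<alpha> \<in> Hom K X (?S X)" for X \<alpha>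
      using star.st_in[folded K_def, of "?S X" "?E X X \<alpha>"] that by (simp add: sat_def)
    have st_in [simp]: "st X \<alpha> \<in> Hom K X (?S X)" if "X \<in> Ob C" "\<alpha> \<in> Hom K X (?S X)" for X \<alpha>
      unfolding st_def using that by (intro K.Comp_in) simp_all
    \<comment> \<open>This is the assumed equation. It enters in the inequality \<open>st\<close>
      after \<open>st\<close> below \<open>st\<close>, where composition in \<open>?L\<close>
      extends the left factor.\<close>
    have E_st: "?E X X (st X \<alpha>) = sat X \<alpha>" if "X \<in> Ob C" "\<alpha> \<in> Hom K X (?S X)" for X \<alpha>
      using assms(6)[of X \<alpha>] that unfolding K_def[symmetric]
      by (simp add: Let_def st_def sat_def kleisli_ext_def)
    have E_e: "Comp K X (?S X) (?S X) (?E X X \<alpha>) (?e X) = \<alpha>"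
      if "X \<in> Ob C" "\<alpha> \<in> Hom K X (?S X)" for X \<alpha>
      using M.kleisli_ext_Comp_munit[of X X \<alpha>] that by simp
    have Ident_e: "Comp K X (?S X) (?S X) (Ident K (?S X)) (?e X) = ?e X" if "X \<in> Ob C" for X
      using that by (intro K.Comp_Ident_left) simp_all
    \<comment> \<open>Composing in \<open>?L\<close> with an induced arrow on the left is composing
      in \<open>K\<close> with S' of \<open>sharp C T X Y f\<close>; on the right it is composing
      with \<open>sharp C T X Y f\<close> itself.\<close>
    have sharp_Comp: "Comp ?L X X Y (sharp C ?TS X Y f) \<alpha>
        = Comp K X (?S X) (?S Y) (amap S' X Y (sharp C T X Y f)) \<alpha>"
      if "X \<in> Ob C" "Y \<in> Ob C" "f \<in> Hom C X Y" "\<alpha> \<in> Hom K X (?S X)" for X Y f \<alpha>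
      using that M.sharp_in[of X Y "sharp C T X Y f"]
      by (simp only: sharp_L Comp_L Ob sharp_in M.kleisli_ext_sharp)
    have Comp_sharp: "Comp ?L X Y Y \<beta> (sharp C ?TS X Y f) = Comp K X Y (?S Y) \<beta> (sharp C T X Y f)"
      if "X \<in> Ob C" "Y \<in> Ob C" "f \<in> Hom C X Y" "\<beta> \<in> Hom K Y (?S Y)" for X Y f \<beta>
      using that M.sharp_in[of X Y "sharp C T X Y f"]
        M.kleisli_Comp_sharp[of X Y Y "sharp C T X Y f" \<beta>]
      by (simp only: sharp_L Comp_L Ob sharp_in kleisli_simps(4)[of K])
    \<comment> \<open>The lifting property: S' sends an arrow induced from \<open>C\<close> to one
      induced by S f, so the lax axioms of \<open>star\<close> apply to it.\<close>
    have amap_sharp: "amap S' X Y (sharp C T X Y f) = sharp C T (?S X) (?S Y) (amap S X Y f)"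
      and amap_S: "amap S X Y f \<in> Hom C (?S X) (?S Y)"
      if "X \<in> Ob C" "Y \<in> Ob C" "f \<in> Hom C X Y" for X Y f
      using that assms(3) cat_functor.amap_in[of C C S X Y f] by (simp_all add: lifts_def)
    have sharp_st: "Comp K X (?S X) (?S Y) (amap S' X Y (sharp C T X Y f)) (st X \<alpha>)
        = Comp K X (?S X) (?S Y) (Comp K (?S X) (?S X) (?S Y)
            (amap S' X Y (sharp C T X Y f)) (sat X \<alpha>)) (?e X)"
      if "X \<in> Ob C" "Y \<in> Ob C" "f \<in> Hom C X Y" "\<alpha> \<in> Hom K X (?S X)" for X Y f \<alpha>
      unfolding st_def using that M.amap_in[of X Y "sharp C T X Y f"]
      by (intro K.Comp_assoc) simp_all
    \<comment> \<open>Naturality of the unit moves the base arrow across it. Both sides of the lax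
      conditions then have the form of an arrow out of S X precomposed with the unit at X.\<close>
    have st_sharp: "Comp K X Y (?S Y) (st Y \<beta>) (sharp C T X Y f)
        = Comp K X (?S X) (?S Y) (Comp K (?S X) (?S Y) (?S Y)
            (sat Y \<beta>) (amap S' X Y (sharp C T X Y f))) (?e X)"
      if "X \<in> Ob C" "Y \<in> Ob C" "f \<in> Hom C X Y" "\<beta> \<in> Hom K Y (?S Y)" for X Y f \<beta>
    proof -
      note [simp] = that M.amap_in[of X Y "sharp C T X Y f", simplified]
      have "Comp K X Y (?S Y) (st Y \<beta>) (sharp C T X Y f)
          = Comp K X (?S Y) (?S Y) (sat Y \<beta>) (Comp K X Y (?S Y) (?e Y) (sharp C T X Y f))"
        unfolding st_def by (intro K.Comp_assoc[symmetric]) simp_all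
      also have "Comp K X Y (?S Y) (?e Y) (sharp C T X Y f)
          = Comp K X (?S X) (?S Y) (amap S' X Y (sharp C T X Y f)) (?e X)"
        by (intro M.munit_nat) simp_all
      also have "Comp K X (?S Y) (?S Y) (sat Y \<beta>) \<dots>
          = Comp K X (?S X) (?S Y) (Comp K (?S X) (?S Y) (?S Y)
              (sat Y \<beta>) (amap S' X Y (sharp C T X Y f))) (?e X)"
        by (intro K.Comp_assoc) simp_all
      finally show ?thesis .
    qed
    show ?thesis
    proof (rule saturation.intro, unfold Hom_L)
      fix X \<alpha> assume [simp]: "X \<in> Ob C" "\<alpha> \<in> Hom K X (?S X)"
      have [simp]: "Ident K (?S X) \<in> Hom K (?S X) (?S X)"
        by (intro K.Ident_in) simp
      show "st X \<alpha> \<in> Hom K X (?S X)" by simp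
      \<comment> \<open>The first three axioms are those of \<open>star\<close> at the extension of
        \<alpha>, precomposed with the unit; the unit turns the identity into \<open>?e X\<close>
        and the extension of \<alpha> back into \<alpha>.\<close>
      have "le (?S X) (?S X) (Ident K (?S X)) (sat X \<alpha>)"
        unfolding sat_def using star.Ident_le_st[folded K_def, of "?S X" "?E X X \<alpha>"] by simp
      then have "le X (?S X) (Comp K X (?S X) (?S X) (Ident K (?S X)) (?e X)) (st X \<alpha>)"
        unfolding st_def by (intro Comp_right_mono) simp_all
      then show "le X (?S X) (Ident ?L X) (st X \<alpha>)"
        by (simp only: Ident_L Ident_e \<open>X \<in> Ob C\<close>)
      have "le (?S X) (?S X) (?E X X \<alpha>) (sat X \<alpha>)"
        unfolding sat_def using star.le_st[folded K_def, of "?S X" "?E X X \<alpha>"] by simp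
      then have "le X (?S X) (Comp K X (?S X) (?S X) (?E X X \<alpha>) (?e X)) (st X \<alpha>)"
        unfolding st_def by (intro Comp_right_mono) simp_all
      then show "le X (?S X) \<alpha> (st X \<alpha>)"
        by (simp add: E_e)
      have "le (?S X) (?S X) (Comp K (?S X) (?S X) (?S X) (sat X \<alpha>) (sat X \<alpha>)) (sat X \<alpha>)"
        unfolding sat_def using star.st_st_le[folded K_def, of "?S X" "?E X X \<alpha>"] by simp
      then have "le X (?S X) (Comp K X (?S X) (?S X)
          (Comp K (?S X) (?S X) (?S X) (sat X \<alpha>) (sat X \<alpha>)) (?e X)) (st X \<alpha>)"
        by (subst st_def, intro Comp_right_mono) (simp_all add: K.Comp_in)
      also have "Comp K X (?S X) (?S X) (Comp K (?S X) (?S X) (?S X) (sat X \<alpha>) (sat X \<alpha>)) (?e X)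
          = Comp K X (?S X) (?S X) (sat X \<alpha>) (st X \<alpha>)"
        unfolding st_def by (intro K.Comp_assoc[symmetric]) simp_all
      also have "\<dots> = Comp ?L X X X (st X \<alpha>) (st X \<alpha>)"
        by (simp only: Comp_L E_st st_in \<open>X \<in> Ob C\<close> \<open>\<alpha> \<in> Hom K X (?S X)\<close>)
      finally show "le X (?S X) (Comp ?L X X X (st X \<alpha>) (st X \<alpha>)) (st X \<alpha>)" .
    next
      fix X \<alpha> \<beta>
      assume a: "X \<in> Ob C" "\<alpha> \<in> Hom K X (?S X)" "\<beta> \<in> Hom K X (?S X)"
        and b: "le X (?S X) (Ident ?L X) \<beta>" "le X (?S X) \<alpha> \<beta>"
          "le X (?S X) (Comp ?L X X X \<beta> \<beta>) \<beta>"
      have b1: "le X (?S X) (?e X) \<beta>" using b(1) a by (simp only: Ident_L)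
      have b3: "le X (?S X) (Comp K X (?S X) (?S X) (?E X X \<beta>) \<beta>) \<beta>"
        using b(3) a by (simp only: Comp_L)
      note [simp] = a
      \<comment> \<open>Extending the three assumptions on \<beta> makes its extension a competitor
        for \<open>star\<close> at the extension of \<alpha>. Precomposing the resulting bound with
        the unit recovers \<beta>.\<close>
      have "le (?S X) (?S X) (Ident K (?S X)) (?E X X \<beta>)"
        using E_mono[OF _ _ _ _ b1] M.kleisli_ext_munit[of X] by simp
      moreover have "le (?S X) (?S X) (?E X X \<alpha>) (?E X X \<beta>)"
        using b(2) by (intro E_mono) simp_all
      moreover have "le (?S X) (?S X) (Comp K (?S X) (?S X) (?S X) (?E X X \<beta>) (?E X X \<beta>)) (?E X X \<beta>)"
        using E_mono[OF _ _ _ _ b3] M.kleisli_ext_Comp[of X X X \<beta> \<beta>] by (simp add: K.Comp_in)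
      ultimately have "le (?S X) (?S X) (sat X \<alpha>) (?E X X \<beta>)"
        unfolding sat_def
        using star.st_least[folded K_def, of "?S X" "?E X X \<alpha>" "?E X X \<beta>"] by simp
      then have "le X (?S X) (st X \<alpha>) (Comp K X (?S X) (?S X) (?E X X \<beta>) (?e X))"
        unfolding st_def by (intro Comp_right_mono) simp_all
      then show "le X (?S X) (st X \<alpha>) \<beta>" by (simp add: E_e)
    next
      fix X Y f \<alpha> \<beta>
      assume a: "X \<in> Ob C" "Y \<in> Ob C" "f \<in> Hom C X Y" "\<alpha> \<in> Hom K X (?S X)" "\<beta> \<in> Hom K Y (?S Y)"
      let ?f = "sharp C T X Y f"
      let ?Sf = "amap S' X Y ?f"
      have Sf: "?Sf \<in> Hom K (?S X) (?S Y)" using a M.amap_in[of X Y ?f] by simp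
      note [simp] = a Sf
      have in1: "Comp K X (?S X) (?S Y) ?Sf \<alpha> \<in> Hom K X (?S Y)"
        and in2: "Comp K X Y (?S Y) \<beta> ?f \<in> Hom K X (?S Y)"
        and in3: "Comp K (?S X) (?S X) (?S Y) ?Sf (sat X \<alpha>) \<in> Hom K (?S X) (?S Y)"
        and in4: "Comp K (?S X) (?S Y) (?S Y) (sat Y \<beta>) ?Sf \<in> Hom K (?S X) (?S Y)"
        by (simp_all add: K.Comp_in)
      note E1 = M.kleisli_ext_Comp_amap[of X X Y \<alpha> ?f, simplified]
      note E2 = M.kleisli_ext_Comp_base[of X Y Y ?f \<beta>, simplified]
      {
        assume "le X (?S Y) (Comp ?L X X Y (sharp C ?TS X Y f) \<alpha>)
          (Comp ?L X Y Y \<beta> (sharp C ?TS X Y f))"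
        then have "le X (?S Y) (Comp K X (?S X) (?S Y) ?Sf \<alpha>) (Comp K X Y (?S Y) \<beta> ?f)"
          using a by (simp only: sharp_Comp Comp_sharp)
        \<comment> \<open>Extending both sides replaces f by S f and \<alpha>, \<beta> by their
          extensions, which are endomorphisms in \<open>K\<close>. The lax axiom of
          \<open>star\<close> then saturates them, and precomposition with the unit returns to
          \<open>st\<close>.\<close>
        then have "le (?S X) (?S Y) (Comp K (?S X) (?S X) (?S Y) ?Sf (?E X X \<alpha>))
            (Comp K (?S X) (?S Y) (?S Y) (?E Y Y \<beta>) ?Sf)"
          using E_mono[OF _ _ in1 in2] by (simp add: E1 E2)
        then have "le (?S X) (?S Y) (Comp K (?S X) (?S X) (?S Y) ?Sf (sat X \<alpha>))
            (Comp K (?S X) (?S Y) (?S Y) (sat Y \<beta>) ?Sf)"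
          unfolding sat_def amap_sharp[OF a(1-3)]
          by (intro star.st_lax[folded K_def]) (simp_all add: amap_S)
        then have "le X (?S Y) (Comp K X (?S X) (?S Y) ?Sf (st X \<alpha>)) (Comp K X Y (?S Y) (st Y \<beta>) ?f)"
          unfolding sharp_st[OF a(1-4)] st_sharp[OF a(1-3,5)]
          using in3 in4 by (intro Comp_right_mono) simp_all
        then show "le X (?S Y) (Comp ?L X X Y (sharp C ?TS X Y f) (st X \<alpha>))
          (Comp ?L X Y Y (st Y \<beta>) (sharp C ?TS X Y f))"
          using a by (simp only: sharp_Comp Comp_sharp st_in)
      next
        assume "le X (?S Y) (Comp ?L X Y Y \<beta> (sharp C ?TS X Y f))
          (Comp ?L X X Y (sharp C ?TS X Y f) \<alpha>)"
        then have "le X (?S Y) (Comp K X Y (?S Y) \<beta> ?f) (Comp K X (?S X) (?S Y) ?Sf \<alpha>)"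
          using a by (simp only: sharp_Comp Comp_sharp)
        \<comment> \<open>The same passage with the inequality reversed, through
          \<open>st_oplax\<close>.\<close>
        then have "le (?S X) (?S Y) (Comp K (?S X) (?S Y) (?S Y) (?E Y Y \<beta>) ?Sf)
            (Comp K (?S X) (?S X) (?S Y) ?Sf (?E X X \<alpha>))"
          using E_mono[OF _ _ in2 in1] by (simp add: E1 E2)
        then have "le (?S X) (?S Y) (Comp K (?S X) (?S Y) (?S Y) (sat Y \<beta>) ?Sf)
            (Comp K (?S X) (?S X) (?S Y) ?Sf (sat X \<alpha>))"
          unfolding sat_def amap_sharp[OF a(1-3)]
          by (intro star.st_oplax[folded K_def]) (simp_all add: amap_S)
        then have "le X (?S Y) (Comp K X Y (?S Y) (st Y \<beta>) ?f) (Comp K X (?S X) (?S Y) ?Sf (st X \<alpha>))"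
          unfolding sharp_st[OF a(1-4)] st_sharp[OF a(1-3,5)]
          using in3 in4 by (intro Comp_right_mono) simp_all
        then show "le X (?S Y) (Comp ?L X Y Y (st Y \<beta>) (sharp C ?TS X Y f))
          (Comp ?L X X Y (sharp C ?TS X Y f) (st X \<alpha>))"
          using a by (simp only: sharp_Comp Comp_sharp st_in)
      }
    qed
  qed
  ultimately show ?thesis
    using TS by (auto simp: ordered_saturation_monad_def)
qed

end
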